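(* Let $\mathcal{H}$ be a real Hilbert space, let $\lambda>0$, $\mu=\frac1\lambda$, and let $\Phi:\mathcal{H}\to\mathbb{R}^+$ be a convex differentiable function whose gradient is $L$-Lipschitz continuous for some $L>0$, with $C=\mathrm{argmin}\,\Phi=\Phi^{-1}(0)\neq\emptyset$, and assume $\mu L<1$. Let $\varepsilon:[0,+\infty[\to[0,+\infty[$ satisfy: (H1) for every $p\in R(N_C)$, $\displaystyle\int_0^{+\infty}\Big(\mu\Phi^*\big(\tfrac{1}{\mu}\varepsilon(t)p\big)-\sigma_C(\varepsilon(t)p)+\tfrac12\|\varepsilon(t)p\|^2\Big)dt<+\infty$; (H2) $\varepsilon(\cdot)$ is nonincreasing, of class $C^1$, Lipschitz continuous on $[0,+\infty[$, $\lim_{t\to+\infty}\varepsilon(t)=0$, $\int_0^{+\infty}\varepsilon(t)dt=+\infty$, and for some $k\ge0$, $-k\varepsilon^2\le\dot\varepsilon$. Let $(x(\cdot),\upsilon(\cdot))$ be a strong global solution of $$\upsilon(t)=\nabla\Phi(x(t)),\qquad \lambda\dot x(t)+\dot\upsilon(t)+\upsilon(t)+\varepsilon(t)x(t)=0,$$ and set $y(t)=x(t)+\mu\upsilon(t)$. Then $x(t)$ and $y(t)$ converge strongly, as $t\to+\infty$, to the element of minimal norm of $C$.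
   Context: $\Phi^*$ is the Fenchel conjugate of $\Phi$; $\sigma_C(x^* )=\sup_{c\in C}\langle x^*,c\rangle$; $N_C(x)=\{x^*:\langle x^*,c-x\rangle\le0\ \forall c\in C\}$ for $x\in C$ and $R(N_C)=\bigcup_{x\in C}N_C(x)$. A strong global solution means $x,\upsilon$ absolutely continuous on every bounded interval, the inclusion holding for all $t\ge0$ and the differential equation for almost every $t\ge0$. *)

theory Defs
  imports "HOL-Analysis.Analysis"
begin

definition fenchel_conj :: "('a::real_inner \<Rightarrow> real) \<Rightarrow> 'a \<Rightarrow> ereal" where
  "fenchel_conj \<Phi> y = (SUP x. ereal (y \<bullet> x - \<Phi> x))"

definition support_fun :: "'a::real_inner set \<Rightarrow> 'a \<Rightarrow> ereal" where
  "support_fun C y = (SUP c\<in>C. ereal (y \<bullet> c))"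

text \<open>Normal cone of C at x (for x in C).\<close>
definition normal_cone :: "'a::real_inner set \<Rightarrow> 'a \<Rightarrow> 'a set" where
  "normal_cone C x = {p. \<forall>c\<in>C. p \<bullet> (c - x) \<le> 0}"

definition range_normal_cone :: "'a::real_inner set \<Rightarrow> 'a set" where
  "range_normal_cone C = (\<Union>x\<in>C. normal_cone C x)"

definition abs_continuous_on :: "real set \<Rightarrow> (real \<Rightarrow> 'a::real_normed_vector) \<Rightarrow> bool" where
  "abs_continuous_on S f \<longleftrightarrow>
    (\<forall>e>0. \<exists>d>0. \<forall>(n::nat) (a::nat \<Rightarrow> real) b.
       (\<forall>i<n. a i \<le> b i \<and> {a i..b i} \<subseteq> S) \<and>
       (\<forall>i<n. \<forall>j<n. i \<noteq> j \<longrightarrow> b i \<le> a j \<or> b j \<le> a i) \<and>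
       (\<Sum>i<n. b i - a i) < d
       \<longrightarrow> (\<Sum>i<n. norm (f (b i) - f (a i))) < e)"

end

theory Submission
  imports Defs
begin

text \<open>
  With \<open>y = x + \<mu> \<upsilon>\<close> the system reads \<open>y' = - \<mu> (\<upsilon> + \<epsilon> x)\<close>. Let \<open>p\<close> be the element of minimal norm of
  \<open>C\<close>. Convexity of \<open>\<Phi> + \<epsilon>/2 \<bar>\<cdot>\<bar>\<^sup>2\<close>, together with the fact that its infimum is at least
  \<open>\<epsilon>/2 (\<bar>p\<bar>\<^sup>2 - \<delta>)\<close> once \<open>\<epsilon>\<close> is small, gives the differential inequality
  \<open>\<theta>' \<le> - \<mu>/4 \<epsilon> (\<theta> - 5 \<delta>)\<close> for \<open>\<theta> = \<bar>y - p\<bar>\<^sup>2\<close> and large times. As \<open>\<epsilon>\<close> is not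
  integrable, \<open>limsup \<theta> \<le> 5 \<delta>\<close> for every \<open>\<delta> > 0\<close>; and \<open>\<bar>x - p\<bar> \<le> \<bar>y - p\<bar>\<close> because \<open>\<nabla>\<Phi>\<close>
  is monotone and vanishes at \<open>p\<close>.

  The equation only holds almost everywhere, but its right-hand side is continuous, so the
  fundamental theorem of calculus for absolutely continuous functions makes \<open>y\<close> of class
  \<open>C\<^sup>1\<close>; this theorem follows from a gauge that is fine near the exceptional null set.
\<close>

subsection \<open>Absolutely continuous functions\<close>

lemma abs_continuous_onD:
  fixes f :: "real \<Rightarrow> 'a::real_normed_vector"
  assumes "abs_continuous_on S f" "e > 0"
  shows "\<exists>d>0. \<forall>(n::nat) u v.
       (\<forall>i<n. u i \<le> v i \<and> {u i..v i} \<subseteq> S) \<longrightarrow>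
       (\<forall>i<n. \<forall>j<n. i \<noteq> j \<longrightarrow> v i \<le> u j \<or> v j \<le> u i) \<longrightarrow>
       (\<Sum>i<n. v i - u i) < d \<longrightarrow> (\<Sum>i<n. norm (f (v i) - f (u i))) < e"
  using assms(1)[unfolded abs_continuous_on_def, rule_format, OF assms(2)]
  by (simp only: imp_conjL)

lemma abs_continuous_onI:
  fixes f :: "real \<Rightarrow> 'a::real_normed_vector"
  assumes "\<And>e. e > 0 \<Longrightarrow> \<exists>d>0. \<forall>(n::nat) u v.
       (\<forall>i<n. u i \<le> v i \<and> {u i..v i} \<subseteq> S) \<longrightarrow>
       (\<forall>i<n. \<forall>j<n. i \<noteq> j \<longrightarrow> v i \<le> u j \<or> v j \<le> u i) \<longrightarrow>
       (\<Sum>i<n. v i - u i) < d \<longrightarrow> (\<Sum>i<n. norm (f (v i) - f (u i))) < e"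
  shows "abs_continuous_on S f"
  unfolding abs_continuous_on_def imp_conjL by (intro allI impI assms)

lemma abs_continuous_on_subset:
  fixes f :: "real \<Rightarrow> 'a::real_normed_vector"
  assumes f: "abs_continuous_on T f" and ST: "S \<subseteq> T"
  shows "abs_continuous_on S f"
proof (rule abs_continuous_onI)
  fix e :: real assume e: "e > 0"
  obtain d where d: "d > 0" and small_sum: "\<forall>(n::nat) u v.
       (\<forall>i<n. u i \<le> v i \<and> {u i..v i} \<subseteq> T) \<longrightarrow>
       (\<forall>i<n. \<forall>j<n. i \<noteq> j \<longrightarrow> v i \<le> u j \<or> v j \<le> u i) \<longrightarrow>
       (\<Sum>i<n. v i - u i) < d \<longrightarrow> (\<Sum>i<n. norm (f (v i) - f (u i))) < e"
    using abs_continuous_onD[OF f e] by (elim exE conjE)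
  have "(\<Sum>i<n. norm (f (v i) - f (u i))) < e"
    if "\<forall>i<n. u i \<le> v i \<and> {u i..v i} \<subseteq> S"
      "\<forall>i<n. \<forall>j<n. i \<noteq> j \<longrightarrow> v i \<le> u j \<or> v j \<le> u i" "(\<Sum>i<n. v i - u i) < d" for n :: nat and u v
  proof (rule small_sum[rule_format])
    show "u i \<le> v i \<and> {u i..v i} \<subseteq> T" if "i < n" for i
      using \<open>\<forall>i<n. u i \<le> v i \<and> {u i..v i} \<subseteq> S\<close> that ST by (meson subset_trans)
  qed (use that in auto)
  then show "\<exists>d>0. \<forall>(n::nat) u v.
       (\<forall>i<n. u i \<le> v i \<and> {u i..v i} \<subseteq> S) \<longrightarrow>
       (\<forall>i<n. \<forall>j<n. i \<noteq> j \<longrightarrow> v i \<le> u j \<or> v j \<le> u i) \<longrightarrow>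
       (\<Sum>i<n. v i - u i) < d \<longrightarrow> (\<Sum>i<n. norm (f (v i) - f (u i))) < e"
    using d by blast
qed

text \<open>Absolute continuity speaks of enumerated, ordered intervals, the gauge integral of
  finite sets of tagged ones; this is the bridge that lets a short tagged family carry only a small
  total increment of \<open>f\<close>.\<close>

lemma abs_continuous_on_tagged_partial_division:
  fixes f :: "real \<Rightarrow> 'a::real_normed_vector"
  assumes f: "abs_continuous_on {a..b} f" and e: "e > 0"
  obtains d where "d > 0"
    "\<And>p. \<lbrakk>p tagged_partial_division_of {a..b}; (\<Sum>(x,K)\<in>p. measure lborel K) < d\<rbrakk>
       \<Longrightarrow> (\<Sum>(x,K)\<in>p. norm (f (Sup K) - f (Inf K))) < e"
proof -
  obtain d where d: "d > 0" and small_sum: "\<forall>(n::nat) u v.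
       (\<forall>i<n. u i \<le> v i \<and> {u i..v i} \<subseteq> {a..b}) \<longrightarrow>
       (\<forall>i<n. \<forall>j<n. i \<noteq> j \<longrightarrow> v i \<le> u j \<or> v j \<le> u i) \<longrightarrow>
       (\<Sum>i<n. v i - u i) < d \<longrightarrow> (\<Sum>i<n. norm (f (v i) - f (u i))) < e"
    using abs_continuous_onD[OF f e] by (elim exE conjE)
  show thesis
  proof (rule that[OF d])
    fix p assume p: "p tagged_partial_division_of {a..b}" and small: "(\<Sum>(x,K)\<in>p. measure lborel K) < d"
    note pD = tagged_partial_division_ofD[OF p]
    have ivl: "\<exists>u v. K = {u..v} \<and> u \<le> v \<and> Inf K = u \<and> Sup K = v \<and> measure lborel K = v - u"
      if "(x, K) \<in> p" for x K
    proof -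
      obtain u v where "K = cbox u v" using pD(4) \<open>(x, K) \<in> p\<close> by blast
      then have K: "K = {u..v}" by simp
      moreover have "x \<in> K" using pD(2) \<open>(x, K) \<in> p\<close> by blast
      ultimately have "u \<le> v" by simp
      with K show ?thesis by (intro exI[of _ u] exI[of _ v]) simp
    qed
    \<comment> \<open>Degenerate intervals are dropped: having empty interior, they may lie inside
      another member and break the ordering required by \<open>small_sum\<close>. They contribute
      zero to the sum of increments.\<close>
    define q where "q = {(x,K) \<in> p. Inf K < Sup K}"
    have qp: "q \<subseteq> p" by (auto simp: q_def)
    then have finq: "finite q" using pD(1) finite_subset by blast
    have Sup_Inf: "Sup K - Inf K = measure lborel K \<and> Inf K \<le> Sup K" if "(x, K) \<in> p" for x K
      using ivl[OF that] by auto
    obtain h where h: "bij_betw h {..<card q} q"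
      using ex_bij_betw_nat_finite[OF finq] by (auto simp: atLeast0LessThan)
    define u where "u i = Inf (snd (h i))" for i
    define v where "v i = Sup (snd (h i))" for i
    have hq: "h i \<in> q" if "i < card q" for i
      using h that by (auto simp: bij_betw_def)
    have K: "snd (h i) = {u i..v i} \<and> u i < v i" if "i < card q" for i
    proof -
      obtain x K where xK: "h i = (x, K)" by fastforce
      with hq[OF that] have "(x, K) \<in> p" "Inf K < Sup K" by (auto simp: q_def)
      with ivl[OF this(1)] show ?thesis by (auto simp: u_def v_def xK)
    qed
    have "(\<Sum>i<card q. norm (f (v i) - f (u i))) < e"
    proof (rule small_sum[rule_format])
      fix i assume i: "i < card q"
      show "u i \<le> v i \<and> {u i..v i} \<subseteq> {a..b}"
        using pD(3)[of "fst (h i)" "snd (h i)"] hq[OF i] qp K[OF i]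
        by (metis less_imp_le prod.collapse subsetD)
    next
      fix i j assume i: "i < card q" and j: "j < card q" and "i \<noteq> j"
      have "h i \<noteq> h j" using h i j \<open>i \<noteq> j\<close> by (auto simp: bij_betw_def inj_on_def)
      then have "interior (snd (h i)) \<inter> interior (snd (h j)) = {}"
        using pD(5)[of "fst (h i)" "snd (h i)" "fst (h j)" "snd (h j)"] hq[OF i] hq[OF j] qp
        by (metis prod.collapse subsetD)
      then have disj: "{u i<..<v i} \<inter> {u j<..<v j} = {}"
        using K[OF i] K[OF j] by simp
      show "v i \<le> u j \<or> v j \<le> u i"
      proof (rule ccontr)
        assume "\<not> ?thesis"
        then have "max (u i) (u j) < min (v i) (v j)" using K[OF i] K[OF j] by auto
        then obtain z where "max (u i) (u j) < z" "z < min (v i) (v j)" using dense by blast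
        then show False using disj by auto
      qed
    next
      have "(\<Sum>i<card q. v i - u i) = (\<Sum>(x,K)\<in>q. Sup K - Inf K)"
        by (subst sum.reindex_bij_betw[OF h, symmetric]) (simp add: u_def v_def case_prod_beta)
      also have "\<dots> = (\<Sum>(x,K)\<in>q. measure lborel K)"
        using qp Sup_Inf by (intro sum.cong) auto
      also have "\<dots> \<le> (\<Sum>(x,K)\<in>p. measure lborel K)"
        using qp pD(1) by (intro sum_mono2) auto
      finally show "(\<Sum>i<card q. v i - u i) < d" using small by simp
    qed
    also have "(\<Sum>i<card q. norm (f (v i) - f (u i))) = (\<Sum>(x,K)\<in>q. norm (f (Sup K) - f (Inf K)))"
      by (subst sum.reindex_bij_betw[OF h, symmetric]) (simp add: u_def v_def case_prod_beta)
    also have "\<dots> = (\<Sum>(x,K)\<in>p. norm (f (Sup K) - f (Inf K)))"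
    proof (rule sum.mono_neutral_left)
      show "\<forall>i\<in>p - q. (case i of (x, K) \<Rightarrow> norm (f (Sup K) - f (Inf K))) = 0"
        using Sup_Inf by (fastforce simp: q_def)
    qed (use qp pD(1) in auto)
    finally show "(\<Sum>(x,K)\<in>p. norm (f (Sup K) - f (Inf K))) < e" .
  qed
qed

text \<open>Completeness is not assumed, as the sort \<open>{real_inner, complete_space}\<close> does not imply \<open>banach\<close>.\<close>

theorem fundamental_theorem_of_calculus_abs_continuous:
  fixes f :: "real \<Rightarrow> 'a::real_normed_vector"
  assumes ab: "a \<le> b" and f: "abs_continuous_on {a..b} f" and N: "negligible N"
    and vecd: "\<And>t. t \<in> {a..b} - N \<Longrightarrow> (f has_vector_derivative f' t) (at t within {a..b})"
  shows "(f' has_integral (f b - f a)) {a..b}"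
proof (cases "a = b")
  case True
  then show ?thesis by (simp add: has_integral_refl)
next
  case False
  with ab have "a < b" by simp
  \<comment> \<open>With the value 0 on \<open>N\<close>, a tag in \<open>N\<close> leaves only an
    increment of \<open>f\<close> to estimate. The change on a negligible set is undone at the end
    by \<open>has_integral_spike\<close>.\<close>
  define g where "g t = (if t \<in> N then 0 else f' t)" for t
  have "(g has_integral (f b - f a)) {a..b}"
    unfolding has_integral_factor_content_real
  proof (intro allI impI)
    fix e :: real assume "e > 0"
    have "\<forall>t. \<exists>d>0. t \<in> {a..b} - N \<longrightarrow>
        (\<forall>y\<in>{a..b}. norm (y-t) < d \<longrightarrow> norm (f y - f t - (y-t) *\<^sub>R f' t) \<le> (e/2) * norm (y-t))"
      using vecd[unfolded has_vector_derivative_def has_derivative_within_alt] \<open>e > 0\<close>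
      by (metis half_gt_zero zero_less_one)
    then obtain d where d: "\<And>t. 0 < d t"
      "\<And>t y. \<lbrakk>t \<in> {a..b} - N; y \<in> {a..b}; norm (y-t) < d t\<rbrakk>
         \<Longrightarrow> norm (f y - f t - (y-t) *\<^sub>R f' t) \<le> (e/2) * norm (y-t)"
      by metis
    obtain r where r: "r > 0"
      "\<And>p. \<lbrakk>p tagged_partial_division_of {a..b}; (\<Sum>(x,K)\<in>p. measure lborel K) < r\<rbrakk>
         \<Longrightarrow> (\<Sum>(x,K)\<in>p. norm (f (Sup K) - f (Inf K))) < e/2 * (b - a)"
      using abs_continuous_on_tagged_partial_division[OF f, of "e/2 * (b - a)"] \<open>e > 0\<close> \<open>a < b\<close>
      by auto
    \<comment> \<open>The vanishing integral of the indicator is read through its Riemann sums: for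
      divisions fine enough, the intervals tagged in \<open>N\<close> have total length below
      \<open>r\<close>, the threshold supplied by absolute continuity.\<close>
    have "((indicator N :: real \<Rightarrow> real) has_integral 0) (cbox a b)"
      using N unfolding negligible_def by blast
    then have "((indicator N :: real \<Rightarrow> real) has_integral 0) {a..b}" by simp
    then have "\<exists>\<gamma>. gauge \<gamma> \<and> (\<forall>p. p tagged_division_of {a..b} \<and> \<gamma> fine p \<longrightarrow>
        norm ((\<Sum>(x,K)\<in>p. measure lborel K *\<^sub>R (indicator N x :: real)) - 0) < r)"
      unfolding has_integral_real by (rule allE[of _ r]) (erule mp[OF _ r(1)])
    then obtain \<gamma> where \<gamma>: "gauge \<gamma>" and \<gamma>_small:
      "\<forall>p. p tagged_division_of {a..b} \<and> \<gamma> fine p \<longrightarrow>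
         norm ((\<Sum>(x,K)\<in>p. measure lborel K *\<^sub>R (indicator N x :: real)) - 0) < r"
      by (elim exE conjE)
    show "\<exists>\<gamma>. gauge \<gamma> \<and> (\<forall>p. p tagged_division_of {a..b} \<and> \<gamma> fine p \<longrightarrow>
        norm ((\<Sum>(x,K)\<in>p. measure lborel K *\<^sub>R g x) - (f b - f a)) \<le> e * measure lborel {a..b})"
    proof (intro exI conjI allI impI; (elim conjE)?)
      \<comment> \<open>\<open>\<gamma>\<close> controls the intervals with tag in \<open>N\<close>,
        and the balls of radius \<open>d x\<close> make the differential quotient accurate at the
        other tags.\<close>
      show "gauge (\<lambda>x. \<gamma> x \<inter> ball x (d x))"
        using \<gamma> d(1) by (intro gauge_Int gauge_ball_dependent) auto
      fix p assume p: "p tagged_division_of {a..b}" and "(\<lambda>x. \<gamma> x \<inter> ball x (d x)) fine p"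
      then have fine: "\<gamma> fine p" "(\<lambda>x. ball x (d x)) fine p"
        by (auto simp: fine_Int)
      note pD = tagged_division_ofD[OF p]
      define q where "q = {(x,K) \<in> p. x \<in> N}"
      have qp: "q \<subseteq> p" by (auto simp: q_def)
      have q: "q tagged_partial_division_of {a..b}"
        using p qp tagged_partial_division_subset unfolding tagged_division_of_def by blast
      have "(\<Sum>(x,K)\<in>q. measure lborel K) = (\<Sum>(x,K)\<in>q. measure lborel K *\<^sub>R (indicator N x :: real))"
        by (rule sum.cong) (auto simp: q_def)
      also have "\<dots> = (\<Sum>(x,K)\<in>p. measure lborel K *\<^sub>R (indicator N x :: real))"
        using qp pD(1) by (intro sum.mono_neutral_left) (auto simp: q_def indicator_def)
      also have "\<dots> < r"
        using \<gamma>_small[THEN spec, THEN mp, OF conjI, OF p fine(1)] by simp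
      finally have qN: "(\<Sum>(x,K)\<in>q. norm (f (Sup K) - f (Inf K))) < e/2 * (b - a)"
        using r(2)[OF q] by blast
      have tele: "b - a = (\<Sum>(x,K)\<in>p. Sup K - Inf K)" "f b - f a = (\<Sum>(x,K)\<in>p. f (Sup K) - f (Inf K))"
        using additive_tagged_division_1[OF ab p, of "\<lambda>x. x"] additive_tagged_division_1[OF ab p, of f]
        by auto
      have est: "norm (measure lborel K *\<^sub>R g x - (f (Sup K) - f (Inf K)))
          \<le> e/2 * (Sup K - Inf K) + (if x \<in> N then norm (f (Sup K) - f (Inf K)) else 0)"
        if xK: "(x, K) \<in> p" for x K
      proof -
        obtain u v where "K = cbox u v" using pD(4) xK by blast
        then have K: "K = {u..v}" by simp
        have x: "x \<in> K" "K \<subseteq> {a..b}" using pD(2,3) xK by blast+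
        then have uv: "u \<le> x" "x \<le> v" "u \<in> {a..b}" "v \<in> {a..b}" "x \<in> {a..b}"
          using K by auto
        show ?thesis
        proof (cases "x \<in> N")
          case True
          then show ?thesis using K uv \<open>e > 0\<close> by (simp add: g_def norm_minus_commute)
        next
          case False
          have "K \<subseteq> ball x (d x)" using fine(2) xK by blast
          then have "u \<in> ball x (d x)" "v \<in> ball x (d x)"
            using K uv by (simp_all add: subset_iff del: mem_ball)
          then have near: "norm (u - x) < d x" "norm (v - x) < d x"
            by (auto simp: dist_real_def)
          \<comment> \<open>Straddle argument: the increment over \<open>{u..v}\<close> is split at
            the tag \<open>x\<close>, and the two error bounds add up because
            \<open>\<bar>u - x\<bar> + \<bar>v - x\<bar> = v - u\<close>.\<close>
          have "measure lborel K *\<^sub>R g x - (f (Sup K) - f (Inf K))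
              = (f u - f x - (u - x) *\<^sub>R f' x) - (f v - f x - (v - x) *\<^sub>R f' x)"
            using K uv False by (simp add: g_def algebra_simps)
          also have "norm \<dots> \<le> e/2 * norm (u - x) + e/2 * norm (v - x)"
          proof -
            have "norm (f u - f x - (u - x) *\<^sub>R f' x) \<le> e/2 * norm (u - x)"
              using uv near False by (intro d(2)) auto
            moreover have "norm (f v - f x - (v - x) *\<^sub>R f' x) \<le> e/2 * norm (v - x)"
              using uv near False by (intro d(2)) auto
            ultimately show ?thesis by (rule norm_triangle_le_diff[OF add_mono])
          qed
          also have "\<dots> = e/2 * (Sup K - Inf K)"
            using K uv by (simp add: field_simps)
          finally show ?thesis using False by simp
        qed
      qed
      have "norm ((\<Sum>(x,K)\<in>p. measure lborel K *\<^sub>R g x) - (f b - f a))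
          = norm (\<Sum>(x,K)\<in>p. measure lborel K *\<^sub>R g x - (f (Sup K) - f (Inf K)))"
        by (simp add: tele(2) case_prod_unfold sum_subtractf)
      also have "\<dots> \<le> (\<Sum>(x,K)\<in>p. e/2 * (Sup K - Inf K)
          + (if x \<in> N then norm (f (Sup K) - f (Inf K)) else 0))"
        using est by (intro sum_norm_le) auto
      also have "\<dots> = e/2 * (\<Sum>(x,K)\<in>p. Sup K - Inf K)
          + (\<Sum>(x,K)\<in>p. if x \<in> N then norm (f (Sup K) - f (Inf K)) else 0)"
        by (simp add: case_prod_unfold sum.distrib sum_distrib_left)
      also have "(\<Sum>(x,K)\<in>p. if x \<in> N then norm (f (Sup K) - f (Inf K)) else 0)
          = (\<Sum>(x,K)\<in>q. norm (f (Sup K) - f (Inf K)))"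
        using qp pD(1) by (intro sum.mono_neutral_cong_right) (auto simp: q_def split: if_splits)
      also have "e/2 * (\<Sum>(x,K)\<in>p. Sup K - Inf K) + \<dots> \<le> e/2 * (b - a) + e/2 * (b - a)"
        using qN tele(1) by simp
      also have "\<dots> = e * measure lborel {a..b}"
        using ab by (simp add: field_simps)
      finally show "norm ((\<Sum>(x,K)\<in>p. measure lborel K *\<^sub>R g x) - (f b - f a)) \<le> e * measure lborel {a..b}" .
    qed
  qed
  then show ?thesis
    by (rule has_integral_spike[OF N, rotated]) (auto simp: g_def)
qed

text \<open>The increments of \<open>f\<close> are integrals of \<open>f'\<close>, in which the
  exceptional set has disappeared; continuity of \<open>f'\<close> at \<open>t\<close> then makes
  the difference quotients converge at \<open>t\<close>, whether or not \<open>t\<close> lies in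
  \<open>N\<close>.\<close>

lemma has_vector_derivative_of_AE_abs_continuous:
  fixes f :: "real \<Rightarrow> 'a::real_normed_vector"
  assumes f: "abs_continuous_on {a..b} f" and N: "negligible N"
    and vecd: "\<And>t. t \<in> {a..b} - N \<Longrightarrow> (f has_vector_derivative f' t) (at t within {a..b})"
    and cont: "continuous_on {a..b} f'" and t: "t \<in> {a..b}"
  shows "(f has_vector_derivative f' t) (at t within {a..b})"
  unfolding has_vector_derivative_def has_derivative_within_alt
proof (intro conjI allI impI)
  \<comment> \<open>The error is the integral of \<open>f' - c\<close> over \<open>{u..v}\<close>.
    It is used below with \<open>c = f' t\<close> on the interval between \<open>y\<close> and
    \<open>t\<close>, in either order.\<close>
  have est: "norm (f v - f u - (v - u) *\<^sub>R c) \<le> e * (v - u)"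
    if uv: "a \<le> u" "u \<le> v" "v \<le> b" and e: "\<And>s. s \<in> {u..v} \<Longrightarrow> norm (f' s - c) \<le> e" for u v c e
  proof -
    have "(f' has_integral (f v - f u)) {u..v}"
    proof (rule fundamental_theorem_of_calculus_abs_continuous[OF uv(2) _ N])
      show "abs_continuous_on {u..v} f"
        using uv by (intro abs_continuous_on_subset[OF f]) auto
      show "(f has_vector_derivative f' s) (at s within {u..v})" if "s \<in> {u..v} - N" for s
        using uv that by (intro has_vector_derivative_within_subset[OF vecd]) auto
    qed
    then have "((\<lambda>s. f' s - c) has_integral (f v - f u - (v - u) *\<^sub>R c)) {u..v}"
      using has_integral_const_real[of c u v] uv by (intro has_integral_diff) auto
    moreover have "0 \<le> e" using order_trans[OF norm_ge_zero e[of u]] uv by simp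
    ultimately show ?thesis
      using e uv has_integral_bound[of e "\<lambda>s. f' s - c" _ u v] by auto
  qed
  fix e :: real assume "e > 0"
  then obtain d where d: "d > 0" "\<And>s. s \<in> {a..b} \<Longrightarrow> dist s t < d \<Longrightarrow> dist (f' s) (f' t) < e"
    using cont t unfolding continuous_on_iff by metis
  show "\<exists>d>0. \<forall>y\<in>{a..b}. norm (y - t) < d \<longrightarrow> norm (f y - f t - (y - t) *\<^sub>R f' t) \<le> e * norm (y - t)"
  proof (intro exI[of _ d] conjI ballI impI d(1))
    fix y assume y: "y \<in> {a..b}" "norm (y - t) < d"
    have close: "norm (f' s - f' t) \<le> e" if "s \<in> {min y t..max y t}" for s
      using d(2)[of s] that y t by (simp add: dist_norm abs_if less_imp_le split: if_splits)
    show "norm (f y - f t - (y - t) *\<^sub>R f' t) \<le> e * norm (y - t)"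
    proof (cases "t \<le> y")
      case True
      then show ?thesis using est[of t y "f' t" e] close y t by auto
    next
      case False
      have "norm (f y - f t - (y - t) *\<^sub>R f' t) = norm (f t - f y - (t - y) *\<^sub>R f' t)"
        by (subst norm_minus_cancel[symmetric]) (simp add: algebra_simps)
      then show ?thesis using est[of y t "f' t" e] close y t False by auto
    qed
  qed
qed (rule bounded_linear_scaleR_left)

lemma abs_continuous_on_imp_continuous_on:
  fixes f :: "real \<Rightarrow> 'a::real_normed_vector"
  assumes f: "abs_continuous_on {a..b} f"
  shows "continuous_on {a..b} f"
  unfolding continuous_on_iff
proof (intro ballI allI impI)
  fix t e :: real assume t: "t \<in> {a..b}" and "e > 0"
  obtain d where d: "d > 0" and small_sum: "\<forall>(n::nat) u v.
       (\<forall>i<n. u i \<le> v i \<and> {u i..v i} \<subseteq> {a..b}) \<longrightarrow>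
       (\<forall>i<n. \<forall>j<n. i \<noteq> j \<longrightarrow> v i \<le> u j \<or> v j \<le> u i) \<longrightarrow>
       (\<Sum>i<n. v i - u i) < d \<longrightarrow> (\<Sum>i<n. norm (f (v i) - f (u i))) < e"
    using abs_continuous_onD[OF f \<open>e > 0\<close>] by (elim exE conjE)
  have one: "norm (f v - f u) < e" if "a \<le> u" "u \<le> v" "v \<le> b" "v - u < d" for u v
    using small_sum[rule_format, of "Suc 0" "\<lambda>_. u" "\<lambda>_. v"] that by simp
  show "\<exists>d>0. \<forall>s\<in>{a..b}. dist s t < d \<longrightarrow> dist (f s) (f t) < e"
  proof (intro exI[of _ d] conjI ballI impI d)
    fix s assume "s \<in> {a..b}" "dist s t < d"
    then show "dist (f s) (f t) < e"
      using one[of s t] one[of t s] t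
      by (cases "s \<le> t") (auto simp: dist_norm norm_minus_commute)
  qed
qed

lemma abs_continuous_on_add:
  fixes f g :: "real \<Rightarrow> 'a::real_normed_vector"
  assumes f: "abs_continuous_on S f" and g: "abs_continuous_on S g"
  shows "abs_continuous_on S (\<lambda>t. f t + g t)"
proof (rule abs_continuous_onI)
  fix e :: real assume "e > 0"
  then have e2: "e / 2 > 0" by simp
  obtain d1 where d1: "d1 > 0" and f_small: "\<forall>(n::nat) u v.
       (\<forall>i<n. u i \<le> v i \<and> {u i..v i} \<subseteq> S) \<longrightarrow>
       (\<forall>i<n. \<forall>j<n. i \<noteq> j \<longrightarrow> v i \<le> u j \<or> v j \<le> u i) \<longrightarrow>
       (\<Sum>i<n. v i - u i) < d1 \<longrightarrow> (\<Sum>i<n. norm (f (v i) - f (u i))) < e / 2"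
    using abs_continuous_onD[OF f e2] by (elim exE conjE)
  obtain d2 where d2: "d2 > 0" and g_small: "\<forall>(n::nat) u v.
       (\<forall>i<n. u i \<le> v i \<and> {u i..v i} \<subseteq> S) \<longrightarrow>
       (\<forall>i<n. \<forall>j<n. i \<noteq> j \<longrightarrow> v i \<le> u j \<or> v j \<le> u i) \<longrightarrow>
       (\<Sum>i<n. v i - u i) < d2 \<longrightarrow> (\<Sum>i<n. norm (g (v i) - g (u i))) < e / 2"
    using abs_continuous_onD[OF g e2] by (elim exE conjE)
  show "\<exists>d>0. \<forall>(n::nat) (u::nat \<Rightarrow> real) v.
       (\<forall>i<n. u i \<le> v i \<and> {u i..v i} \<subseteq> S) \<longrightarrow>
       (\<forall>i<n. \<forall>j<n. i \<noteq> j \<longrightarrow> v i \<le> u j \<or> v j \<le> u i) \<longrightarrow>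
       (\<Sum>i<n. v i - u i) < d \<longrightarrow>
       (\<Sum>i<n. norm (f (v i) + g (v i) - (f (u i) + g (u i)))) < e"
  proof (intro exI[of _ "min d1 d2"] conjI allI impI)
    show "min d1 d2 > 0" using d1 d2 by simp
    fix n :: nat and u v
    assume asm: "\<forall>i<n. u i \<le> v i \<and> {u i..v i} \<subseteq> S"
      "\<forall>i<n. \<forall>j<n. i \<noteq> j \<longrightarrow> v i \<le> u j \<or> v j \<le> u i" "(\<Sum>i<n. v i - u i) < min d1 d2"
    have "(\<Sum>i<n. norm (f (v i) + g (v i) - (f (u i) + g (u i))))
        \<le> (\<Sum>i<n. norm (f (v i) - f (u i)) + norm (g (v i) - g (u i)))"
      by (intro sum_mono) (metis add_diff_add norm_triangle_ineq)
    also have "\<dots> = (\<Sum>i<n. norm (f (v i) - f (u i))) + (\<Sum>i<n. norm (g (v i) - g (u i)))"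
      by (rule sum.distrib)
    also have "\<dots> < e / 2 + e / 2"
      using asm by (intro add_strict_mono f_small[rule_format] g_small[rule_format]) simp_all
    finally show "(\<Sum>i<n. norm (f (v i) + g (v i) - (f (u i) + g (u i)))) < e" by simp
  qed
qed

lemma abs_continuous_on_scaleR:
  fixes f :: "real \<Rightarrow> 'a::real_normed_vector"
  assumes f: "abs_continuous_on S f"
  shows "abs_continuous_on S (\<lambda>t. c *\<^sub>R f t)"
proof (rule abs_continuous_onI)
  fix e :: real assume "e > 0"
  \<comment> \<open>The summand 1 keeps the divisor positive when \<open>c = 0\<close>.\<close>
  then have e2: "e / (\<bar>c\<bar> + 1) > 0" by simp
  obtain d where d: "d > 0" and f_small: "\<forall>(n::nat) u v.
       (\<forall>i<n. u i \<le> v i \<and> {u i..v i} \<subseteq> S) \<longrightarrow>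
       (\<forall>i<n. \<forall>j<n. i \<noteq> j \<longrightarrow> v i \<le> u j \<or> v j \<le> u i) \<longrightarrow>
       (\<Sum>i<n. v i - u i) < d \<longrightarrow> (\<Sum>i<n. norm (f (v i) - f (u i))) < e / (\<bar>c\<bar> + 1)"
    using abs_continuous_onD[OF f e2] by (elim exE conjE)
  show "\<exists>d>0. \<forall>(n::nat) (u::nat \<Rightarrow> real) v.
       (\<forall>i<n. u i \<le> v i \<and> {u i..v i} \<subseteq> S) \<longrightarrow>
       (\<forall>i<n. \<forall>j<n. i \<noteq> j \<longrightarrow> v i \<le> u j \<or> v j \<le> u i) \<longrightarrow>
       (\<Sum>i<n. v i - u i) < d \<longrightarrow> (\<Sum>i<n. norm (c *\<^sub>R f (v i) - c *\<^sub>R f (u i))) < e"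
  proof (intro exI[of _ d] conjI allI impI d)
    fix n :: nat and u v
    assume "\<forall>i<n. u i \<le> v i \<and> {u i..v i} \<subseteq> S"
      "\<forall>i<n. \<forall>j<n. i \<noteq> j \<longrightarrow> v i \<le> u j \<or> v j \<le> u i" "(\<Sum>i<n. v i - u i) < d"
    then have small: "(\<Sum>i<n. norm (f (v i) - f (u i))) < e / (\<bar>c\<bar> + 1)"
      by (intro f_small[rule_format]) simp_all
    have "(\<Sum>i<n. norm (c *\<^sub>R f (v i) - c *\<^sub>R f (u i))) = \<bar>c\<bar> * (\<Sum>i<n. norm (f (v i) - f (u i)))"
      by (simp add: sum_distrib_left flip: scaleR_diff_right)
    also have "\<dots> \<le> (\<bar>c\<bar> + 1) * (\<Sum>i<n. norm (f (v i) - f (u i)))"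
      by (intro mult_right_mono sum_nonneg) auto
    also have "\<dots> < e" using small by (simp add: field_simps)
    finally show "(\<Sum>i<n. norm (c *\<^sub>R f (v i) - c *\<^sub>R f (u i))) < e" .
  qed
qed

subsection \<open>Tikhonov regularisation\<close>

text \<open>Along the line through \<open>a\<close> and \<open>b\<close> this is the tangent
  inequality for a convex function of one real variable.\<close>

lemma gradient_inequality:
  fixes f :: "'a::real_inner \<Rightarrow> real"
  assumes f: "convex_on UNIV f" and d: "(f has_derivative (\<lambda>h. g \<bullet> h)) (at a)"
  shows "f a + g \<bullet> (b - a) \<le> f b"
proof -
  define h where "h s = f (a + s *\<^sub>R (b - a))" for s :: real
  have "convex_on UNIV h"
  proof (rule convex_onI)
    fix t r s :: real assume t: "0 < t" "t < 1"
    have "a + ((1 - t) * r + t * s) *\<^sub>R (b - a)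
        = (1 - t) *\<^sub>R (a + r *\<^sub>R (b - a)) + t *\<^sub>R (a + s *\<^sub>R (b - a))"
      by (simp add: algebra_simps)
    then show "h ((1 - t) *\<^sub>R r + t *\<^sub>R s) \<le> (1 - t) * h r + t * h s"
      using convex_onD[OF f, of t "a + r *\<^sub>R (b - a)" "a + s *\<^sub>R (b - a)"] t by (simp add: h_def)
  qed auto
  moreover have "(h has_field_derivative g \<bullet> (b - a)) (at 0)"
  proof -
    have "((\<lambda>s. a + s *\<^sub>R (b - a)) has_derivative (\<lambda>s. s *\<^sub>R (b - a))) (at 0)"
      by (auto intro!: derivative_eq_intros)
    moreover have "(f has_derivative (\<lambda>h. g \<bullet> h)) (at (a + 0 *\<^sub>R (b - a)))"
      using d by simp
    ultimately have "(h has_derivative (\<lambda>s. g \<bullet> (s *\<^sub>R (b - a)))) (at 0)"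
      unfolding h_def by (rule has_derivative_compose)
    then show ?thesis by (simp add: has_field_derivative_def mult.commute[of "g \<bullet> (b - a)"] mult_commute_abs)
  qed
  ultimately have "(g \<bullet> (b - a)) * (1 - 0) \<le> h 1 - h 0"
    by (intro convex_on_imp_above_tangent[where A = UNIV]) auto
  then show ?thesis by (simp add: h_def)
qed

text \<open>The infima \<open>D n\<close> of the squared norm over shrinking sublevel sets increase
  to a limit \<open>l\<close>. Near-minimisers \<open>w n\<close> are Cauchy by the parallelogram
  law, and their limit \<open>p\<close> is a zero with \<open>(norm p)\<^sup>2 \<le> l\<close>. The
  last conclusion, that points with small \<open>f\<close> cannot have norm much below that of
  \<open>p\<close>, then follows from \<open>D n\<close> approaching \<open>l\<close>.\<close>

lemma convex_min_norm_zero: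
  fixes f :: "'a::{real_inner, complete_space} \<Rightarrow> real"
  assumes f: "convex_on UNIV f" and cont: "continuous_on UNIV f"
    and nonneg: "\<And>z. f z \<ge> 0" and z0: "f z0 = 0"
  obtains p where "f p = 0" "\<And>z. f z = 0 \<Longrightarrow> norm p \<le> norm z"
    "\<And>\<delta>. \<delta> > 0 \<Longrightarrow> \<exists>a>0. \<forall>z. f z \<le> a \<longrightarrow> (norm p)\<^sup>2 - \<delta> \<le> (norm z)\<^sup>2"
proof -
  define S where "S n = {z. f z \<le> 1 / real (Suc n)}" for n
  define D where "D n = (INF z\<in>S n. (norm z)\<^sup>2)" for n
  have z0S: "z0 \<in> S n" for n by (simp add: S_def z0)
  have bdd: "bdd_below ((\<lambda>z. (norm z)\<^sup>2) ` A)" for A :: "'a set" by (rule bdd_belowI2[of _ 0]) simp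
  have D_le: "D n \<le> (norm z)\<^sup>2" if "z \<in> S n" for n z
    unfolding D_def using that bdd by (rule cINF_lower[rotated])
  have S_anti: "S m \<subseteq> S n" if "n \<le> m" for n m
  proof -
    have "1 / real (Suc m) \<le> 1 / real (Suc n)" using that by (simp add: frac_le)
    then show ?thesis by (auto simp: S_def intro: order_trans)
  qed
  have "incseq D"
  proof (rule incseq_SucI)
    fix n
    show "D n \<le> D (Suc n)"
      unfolding D_def using z0S[of "Suc n"] S_anti[of n "Suc n"]
      by (intro cINF_superset_mono bdd) auto
  qed
  then obtain l where l: "D \<longlonglongrightarrow> l" "\<And>n. D n \<le> l"
    using D_le[OF z0S] by (meson incseq_convergent)
  have "\<exists>w\<in>S n. (norm w)\<^sup>2 < D n + 1 / real (Suc n)" for n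
    using z0S[of n] by (subst cINF_less_iff[OF _ bdd, symmetric]) (auto simp flip: D_def)
  then obtain w where wS: "\<And>n. w n \<in> S n" and w: "\<And>n. (norm (w n))\<^sup>2 < D n + 1 / real (Suc n)"
    by metis
  \<comment> \<open>The parallelogram law bounds the squared distance by
    \<open>2 * (D n + 1/(n+1)) + 2 * (D m + 1/(m+1)) - 4 * D n\<close>; for \<open>n \<le> m\<close>
    this is at most \<open>r n\<close>, since \<open>D m \<le> l\<close>.\<close>
  define r where "r n = 2 * (l - D n) + 4 * (1 / real (Suc n))" for n
  have inv0: "(\<lambda>n. 1 / real (Suc n)) \<longlonglongrightarrow> 0"
    using LIMSEQ_Suc[OF lim_1_over_n[where 'a = real]] by simp
  have "r \<longlonglongrightarrow> 2 * (l - l) + 4 * 0"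
    unfolding r_def by (intro tendsto_intros l inv0)
  then have r0: "r \<longlonglongrightarrow> 0" by simp
  have close: "(norm (w m - w n))\<^sup>2 \<le> r n" if "n \<le> m" for n m
  proof -
    have wm: "w m \<in> S n" using S_anti[OF that] wS by blast
    \<comment> \<open>Convexity keeps the midpoint in \<open>S n\<close>, so its squared norm is at
      least \<open>D n\<close>.\<close>
    have "f ((1/2) *\<^sub>R w n + (1/2) *\<^sub>R w m) \<le> (1/2) * f (w n) + (1/2) * f (w m)"
      using convex_onD[OF f, of "1/2" "w n" "w m"] by simp
    also have "\<dots> \<le> 1 / real (Suc n)"
      using wS[of n] wm by (simp add: S_def)
    finally have "D n \<le> (norm ((1/2) *\<^sub>R w n + (1/2) *\<^sub>R w m))\<^sup>2"
      by (intro D_le) (simp add: S_def)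
    moreover have "(norm (w m - w n))\<^sup>2
        = 2 * (norm (w n))\<^sup>2 + 2 * (norm (w m))\<^sup>2 - 4 * (norm ((1/2) *\<^sub>R w n + (1/2) *\<^sub>R w m))\<^sup>2"
      unfolding power2_norm_eq_inner by (simp add: algebra_simps inner_commute)
    moreover have "1 / real (Suc m) \<le> 1 / real (Suc n)"
      using that by (simp add: frac_le)
    ultimately show ?thesis
      using w[of n] w[of m] l(2)[of m] unfolding r_def by argo
  qed
  have "Cauchy w"
  proof (rule CauchyI')
    fix e :: real assume "e > 0"
    then have "eventually (\<lambda>n. r n < e\<^sup>2) sequentially"
      using r0 by (intro order_tendstoD(2)) auto
    then obtain M where M: "\<And>n. n \<ge> M \<Longrightarrow> r n < e\<^sup>2"
      by (auto simp: eventually_sequentially)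
    show "\<exists>M. \<forall>m\<ge>M. \<forall>n>m. dist (w m) (w n) < e"
    proof (intro exI allI impI)
      fix m n assume "M \<le> m" "m < n"
      then have "(norm (w m - w n))\<^sup>2 < e\<^sup>2"
        using close[of m n] M[of m] by (simp add: norm_minus_commute)
      then show "dist (w m) (w n) < e"
        unfolding dist_norm using \<open>e > 0\<close> by (auto dest: power_less_imp_less_base)
    qed
  qed
  then obtain p where p: "w \<longlonglongrightarrow> p" using Cauchy_convergent_iff convergent_def by blast
  have "(\<lambda>n. f (w n)) \<longlonglongrightarrow> f p"
    using continuous_on_tendsto_compose[OF cont p] by simp
  then have "f p \<le> 0"
    using inv0 wS by (intro LIMSEQ_le[of "\<lambda>n. f (w n)"]) (auto simp: S_def)
  then have fp: "f p = 0" using nonneg[of p] by simp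
  have "(\<lambda>n. (norm (w n))\<^sup>2) \<longlonglongrightarrow> (norm p)\<^sup>2" "(\<lambda>n. D n + 1 / real (Suc n)) \<longlonglongrightarrow> l + 0"
    by (intro tendsto_intros p l inv0)+
  then have pl: "(norm p)\<^sup>2 \<le> l"
    by (rule LIMSEQ_le[THEN order_trans]) (use w in \<open>auto intro: less_imp_le\<close>)
  show thesis
  proof (rule that[OF fp])
    fix z assume "f z = 0"
    then have "l \<le> (norm z)\<^sup>2"
      by (intro LIMSEQ_le_const2[OF l(1)]) (auto intro!: D_le simp: S_def)
    with pl have "(norm p)\<^sup>2 \<le> (norm z)\<^sup>2" by linarith
    then show "norm p \<le> norm z" by (rule power2_le_imp_le) simp
  next
    fix \<delta> :: real assume "\<delta> > 0"
    then have "eventually (\<lambda>n. l - \<delta> < D n) sequentially"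
      using l by (intro order_tendstoD(1)) auto
    then obtain n where n: "l - \<delta> < D n" by (auto simp: eventually_sequentially)
    show "\<exists>a>0. \<forall>z. f z \<le> a \<longrightarrow> (norm p)\<^sup>2 - \<delta> \<le> (norm z)\<^sup>2"
    proof (intro exI[of _ "1 / real (Suc n)"] conjI allI impI)
      fix z assume "f z \<le> 1 / real (Suc n)"
      then have "D n \<le> (norm z)\<^sup>2" by (intro D_le) (simp add: S_def)
      with n pl show "(norm p)\<^sup>2 - \<delta> \<le> (norm z)\<^sup>2" by linarith
    qed simp
  qed
qed

text \<open>Where \<open>f\<close> is at most \<open>a\<close>, the sublevel bound on the norm
  suffices; elsewhere \<open>f\<close> alone exceeds \<open>a\<close>, which dominates
  \<open>e/2 * (norm p)\<^sup>2\<close>. The estimate holds at every point, so no minimiser of the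
  regularised function has to be followed.\<close>

lemma tikhonov_lower_bound:
  fixes f :: "'a::real_normed_vector \<Rightarrow> real"
  assumes nonneg: "\<And>z. f z \<ge> 0" and a: "a > 0"
    and sub: "\<And>z. f z \<le> a \<Longrightarrow> (norm p)\<^sup>2 - \<delta> \<le> (norm z)\<^sup>2" and "\<delta> > 0"
    and e: "0 \<le> e" "e * (norm p)\<^sup>2 \<le> 2 * a"
  shows "e/2 * ((norm p)\<^sup>2 - \<delta>) \<le> f z + e/2 * (norm z)\<^sup>2"
proof (cases "f z \<le> a")
  case True
  then have "e/2 * ((norm p)\<^sup>2 - \<delta>) \<le> e/2 * (norm z)\<^sup>2"
    using e sub by (intro mult_left_mono) auto
  then show ?thesis using nonneg[of z] by simp
next
  case False
  have "e/2 * ((norm p)\<^sup>2 - \<delta>) \<le> a"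
  proof -
    have "0 \<le> e * \<delta>" using e \<open>\<delta> > 0\<close> by simp
    then show ?thesis using e by (simp add: algebra_simps)
  qed
  also have "\<dots> \<le> f z + e/2 * (norm z)\<^sup>2"
    using False e by (simp add: add_increasing2)
  finally show ?thesis .
qed

text \<open>The left-hand side is the derivative of \<open>\<bar>y - p\<bar>\<^sup>2\<close> along the trajectory \<open>y = X + \<mu> V\<close>.\<close>

lemma tikhonov_drift:
  fixes X V p :: "'a::real_inner"
  assumes mu: "0 < \<mu>" and e: "0 \<le> e" "2 * \<mu> * e * (norm p)\<^sup>2 \<le> \<delta>"
    and tik: "e/2 * ((norm p)\<^sup>2 - \<delta>) \<le> \<phi> + e/2 * (norm X)\<^sup>2"
    and phi: "0 \<le> \<phi>" "\<phi> \<le> V \<bullet> (X - p)" and V: "\<mu> * norm V \<le> norm (X - p)"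
  shows "2 * ((X + \<mu> *\<^sub>R V - p) \<bullet> (- (\<mu> *\<^sub>R (V + e *\<^sub>R X))))
           \<le> - (\<mu>/4 * e * ((norm (X + \<mu> *\<^sub>R V - p))\<^sup>2 - 5 * \<delta>))"
proof -
  define q where "q = X - p"
  define s where "s = norm q"
  have X: "X = p + q" by (simp add: q_def)
  \<comment> \<open>This comparison of \<open>y - p\<close> with \<open>x - p\<close> costs a factor
    4 after squaring, and turns decay in \<open>s\<^sup>2\<close> into decay in the squared norm of
    \<open>y - p\<close>.\<close>
  have "norm (q + \<mu> *\<^sub>R V) \<le> 2 * s"
    using norm_triangle_ineq[of q "\<mu> *\<^sub>R V"] V mu by (simp add: s_def q_def)
  then have "(norm (q + \<mu> *\<^sub>R V))\<^sup>2 \<le> (2 * s)\<^sup>2" by (intro power_mono) auto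
  then have th: "(norm (q + \<mu> *\<^sub>R V))\<^sup>2 \<le> 4 * s\<^sup>2" by simp
  have pV: "- (norm p * norm V) \<le> p \<bullet> V"
    using Cauchy_Schwarz_ineq2[of p V] by linarith
  have phi': "\<phi> \<le> V \<bullet> q" using phi by (simp add: q_def)
  have nX: "(norm X)\<^sup>2 = (norm p)\<^sup>2 + 2 * (p \<bullet> q) + s\<^sup>2"
    unfolding X s_def power2_norm_eq_inner by (simp add: algebra_simps inner_commute)
  have "(q + \<mu> *\<^sub>R V) \<bullet> (V + e *\<^sub>R X) = V \<bullet> q + e * (p \<bullet> q) + e * s\<^sup>2 + \<mu> * (norm V)\<^sup>2
      + \<mu> * e * (p \<bullet> V + V \<bullet> q)"
    unfolding X s_def power2_norm_eq_inner by (simp add: algebra_simps inner_commute)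
  also have "\<dots> \<ge> e * s\<^sup>2 / 2 - e * \<delta> / 2 + \<mu> * (norm V)\<^sup>2 - \<mu> * e * (norm p * norm V)"
  proof -
    have "\<mu> * e * (- (norm p * norm V)) \<le> \<mu> * e * (p \<bullet> V + V \<bullet> q)"
      using pV phi phi' mu e by (intro mult_left_mono) auto
    \<comment> \<open>Expanding the squared norm of \<open>X = p + q\<close> in \<open>tik\<close>
      cancels that of \<open>p\<close>. Half of the term \<open>e * s\<^sup>2\<close> above
      survives.\<close>
    moreover have "- (e * \<delta> / 2) - e * s\<^sup>2 / 2 \<le> \<phi> + e * (p \<bullet> q)"
      using tik unfolding nX by (simp add: algebra_simps)
    ultimately show ?thesis using phi' by (simp add: algebra_simps)
  qed
  finally have "e * s\<^sup>2 / 2 - e * \<delta> / 2 + (\<mu> * (norm V)\<^sup>2 - \<mu> * e * (norm p * norm V))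
      \<le> (q + \<mu> *\<^sub>R V) \<bullet> (V + e *\<^sub>R X)" by simp
  moreover have "\<mu> * (norm V)\<^sup>2 - \<mu> * e * (norm p * norm V) \<ge> - (\<mu> * e\<^sup>2 * (norm p)\<^sup>2 / 4)"
  proof -
    \<comment> \<open>Completing the square: the dissipation \<open>\<mu> * (norm V)\<^sup>2\<close>
      absorbs the cross term with \<open>p\<close>, leaving an error quadratic in
      \<open>e\<close>.\<close>
    have "0 \<le> \<mu> * (norm V - e * norm p / 2)\<^sup>2" using mu by simp
    then show ?thesis by (simp add: power2_eq_square algebra_simps)
  qed
  ultimately have A: "(q + \<mu> *\<^sub>R V) \<bullet> (V + e *\<^sub>R X) \<ge> e * s\<^sup>2 / 2 - e * \<delta> / 2 - \<mu> * e\<^sup>2 * (norm p)\<^sup>2 / 4"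
    by linarith
  \<comment> \<open>The quadratic error is at most \<open>e * \<delta> / 8\<close>; added to
    \<open>e * \<delta> / 2\<close> it gives \<open>5/8 * e * \<delta>\<close>. Since
    \<open>s\<^sup>2\<close> is at least a quarter of the squared norm of \<open>y - p\<close>, the
    factor 1/8 can be taken out, and multiplying by \<open>2 * \<mu>\<close> yields the rate
    \<open>\<mu>/4\<close>.\<close>
  have "e * (2 * \<mu> * e * (norm p)\<^sup>2) \<le> e * \<delta>" using e by (intro mult_left_mono) auto
  then have "\<mu> * e\<^sup>2 * (norm p)\<^sup>2 / 4 \<le> e * \<delta> / 8"
    by (simp add: power2_eq_square algebra_simps)
  moreover have "e * (norm (q + \<mu> *\<^sub>R V))\<^sup>2 \<le> e * (4 * s\<^sup>2)"
    using th e by (intro mult_left_mono)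
  ultimately have "(q + \<mu> *\<^sub>R V) \<bullet> (V + e *\<^sub>R X)
      \<ge> (1/8) * (e * (norm (q + \<mu> *\<^sub>R V))\<^sup>2 - 5 * (e * \<delta>))"
    using A by (simp add: algebra_simps)
  then have "2 * \<mu> * ((1/8) * (e * (norm (q + \<mu> *\<^sub>R V))\<^sup>2 - 5 * (e * \<delta>)))
      \<le> 2 * \<mu> * ((q + \<mu> *\<^sub>R V) \<bullet> (V + e *\<^sub>R X))"
    using mu by (intro mult_left_mono) auto
  then show ?thesis
    by (simp add: q_def algebra_simps)
qed

section \<open>Decay driven by a non-integrable rate\<close>

text \<open>\<open>F\<close> is nondecreasing on \<open>{a..}\<close>. Were it bounded there, it
  would converge to its supremum, and the fundamental theorem on the half-line would make the
  integral finite.\<close>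

lemma antiderivative_at_top_of_nn_integral_infinite:
  fixes f F :: "real \<Rightarrow> real"
  assumes f: "f \<in> borel_measurable borel" "\<And>t. a \<le> t \<Longrightarrow> (F has_real_derivative f t) (at t)"
    "\<And>t. a \<le> t \<Longrightarrow> 0 \<le> f t" and inf: "(\<integral>\<^sup>+ t\<in>{a..}. ennreal (f t) \<partial>lborel) = \<infinity>"
  shows "filterlim F at_top at_top"
proof -
  have mono: "F s \<le> F t" if "a \<le> s" "s \<le> t" for s t
    using that f(2,3) by (intro DERIV_nonneg_imp_nondecreasing[of s t F]) (auto intro: order_trans)
  have unbdd: "\<exists>t\<ge>a. B < F t" for B
  proof (rule ccontr)
    assume "\<not> ?thesis"
    then have B: "\<And>t. a \<le> t \<Longrightarrow> F t \<le> B" by (auto simp: not_less)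
    have bdd: "bdd_above (F ` {a..})" using B by (intro bdd_aboveI2) auto
    define T where "T = (SUP t\<in>{a..}. F t)"
    have "(F \<longlongrightarrow> T) at_top"
    proof (rule order_tendstoI)
      fix c assume "c < T"
      then obtain s where s: "a \<le> s" "c < F s" 
        unfolding T_def by (subst (asm) less_cSUP_iff[OF _ bdd]) auto
      then show "eventually (\<lambda>t. c < F t) at_top"
        using mono by (intro eventually_at_top_linorderI[of s]) (auto intro: less_le_trans)
    next
      fix c assume "T < c"
      moreover have "F t \<le> T" if "a \<le> t" for t
        unfolding T_def using that bdd by (intro cSUP_upper) auto
      ultimately show "eventually (\<lambda>t. F t < c) at_top"
        by (intro eventually_at_top_linorderI[of a]) (auto intro: le_less_trans)
    qed
    then have "(\<integral>\<^sup>+ t\<in>{a..}. ennreal (f t) \<partial>lborel) = ennreal (T - F a)"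
      by (intro nn_integral_FTC_atLeast f)
    then show False using inf by simp
  qed
  show ?thesis
    unfolding filterlim_at_top
  proof
    fix B
    obtain s where "a \<le> s" "B < F s" using unbdd by blast
    then show "eventually (\<lambda>t. B \<le> F t) at_top"
      using mono by (intro eventually_at_top_linorderI[of s]) (meson less_imp_le order_trans)
  qed
qed

text \<open>Multiplication by the integrating factor \<open>exp (c * F t)\<close> makes
  \<open>\<theta> - M\<close> nonincreasing, so \<open>\<theta> - M\<close> is bounded by a constant
  times \<open>exp (- (c * F t))\<close>, which tends to 0.\<close>

lemma eventually_le_of_linear_decay:
  fixes \<theta> \<theta>' F f :: "real \<Rightarrow> real"
  assumes th: "\<And>t. T \<le> t \<Longrightarrow> (\<theta> has_real_derivative \<theta>' t) (at t)"
    and F: "\<And>t. T \<le> t \<Longrightarrow> (F has_real_derivative f t) (at t)"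
    and le: "\<And>t. T \<le> t \<Longrightarrow> \<theta>' t \<le> - (c * f t * (\<theta> t - M))"
    and c: "c > 0" and lim: "filterlim F at_top at_top" and M: "M < M'"
  shows "eventually (\<lambda>t. \<theta> t < M') at_top"
proof -
  define h where "h t = exp (c * F t) * (\<theta> t - M)" for t
  have h_le: "h t \<le> h T" if "T \<le> t" for t
  proof (rule DERIV_nonpos_imp_nonincreasing[OF that])
    fix u assume u: "T \<le> u" "u \<le> t"
    have "(h has_real_derivative exp (c * F u) * (c * f u * (\<theta> u - M) + \<theta>' u)) (at u)"
      unfolding h_def using th[OF u(1)] F[OF u(1)]
      by (auto intro!: derivative_eq_intros simp: algebra_simps)
    moreover have "exp (c * F u) * (c * f u * (\<theta> u - M) + \<theta>' u) \<le> 0"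
      using le[OF u(1)] by (intro mult_nonneg_nonpos) auto
    ultimately show "\<exists>y. (h has_real_derivative y) (at u) \<and> y \<le> 0" by blast
  qed
  have "filterlim (\<lambda>t. - (c * F t)) at_bot at_top"
    using filterlim_tendsto_pos_mult_at_top[OF tendsto_const c lim]
    by (simp add: filterlim_uminus_at_bot)
  then have "((\<lambda>t. exp (- (c * F t))) \<longlongrightarrow> 0) at_top"
    by (rule filterlim_compose[OF exp_at_bot])
  then have "((\<lambda>t. M + h T * exp (- (c * F t))) \<longlongrightarrow> M + h T * 0) at_top"
    by (intro tendsto_intros)
  then have "eventually (\<lambda>t. M + h T * exp (- (c * F t)) < M') at_top"
    using M by (intro order_tendstoD(2)) auto
  then show ?thesis
    using eventually_ge_at_top[of T]
  proof eventually_elim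
    case (elim t)
    have "\<theta> t - M = h t * exp (- (c * F t))"
      by (simp add: h_def exp_minus)
    also have "\<dots> \<le> h T * exp (- (c * F t))"
      using h_le elim by (intro mult_right_mono) auto
    finally show ?case using elim by linarith
  qed
qed

section \<open>Strong convergence of the trajectory\<close>

theorem theorem3p3:
  fixes \<Phi> :: "'a::{real_inner, complete_space} \<Rightarrow> real"
    and gradPhi :: "'a \<Rightarrow> 'a"
    and lam \<mu> L k :: real
    and \<epsilon> \<epsilon>' :: "real \<Rightarrow> real"
    and x \<upsilon> :: "real \<Rightarrow> 'a"
    and C :: "'a set"
  assumes lam: "lam > 0" and mu: "\<mu> = 1 / lam"
    and Phi_nonneg: "\<And>z. \<Phi> z \<ge> 0"
    and Phi_convex: "convex_on UNIV \<Phi>"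
    and Phi_grad: "\<And>z. (\<Phi> has_derivative (\<lambda>h. gradPhi z \<bullet> h)) (at z)"
    and L_pos: "L > 0"
    and grad_lip: "\<And>a b. norm (gradPhi a - gradPhi b) \<le> L * norm (a - b)"
    and C_def: "C = {z. \<Phi> z = 0}"
    and C_argmin: "C = {z. \<forall>w. \<Phi> z \<le> \<Phi> w}"
    and C_ne: "C \<noteq> {}"
    and muL: "\<mu> * L < 1"
    and eps_nonneg: "\<And>t. t \<ge> 0 \<Longrightarrow> \<epsilon> t \<ge> 0"
    and H1: "\<And>p. p \<in> range_normal_cone C \<Longrightarrow>
      (\<integral>\<^sup>+ t\<in>{0..}. e2ennreal (ereal \<mu> * fenchel_conj \<Phi> ((1 / \<mu>) *\<^sub>R (\<epsilon> t *\<^sub>R p))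
            - support_fun C (\<epsilon> t *\<^sub>R p) + ereal ((1/2) * (norm (\<epsilon> t *\<^sub>R p))\<^sup>2)) \<partial>lborel) < \<infinity>"
    and eps_antimono: "\<And>s t. 0 \<le> s \<Longrightarrow> s \<le> t \<Longrightarrow> \<epsilon> t \<le> \<epsilon> s"
    and eps_C1: "\<And>t. t \<ge> 0 \<Longrightarrow> (\<epsilon> has_real_derivative \<epsilon>' t) (at t within {0..})"
    and eps'_cont: "continuous_on {0..} \<epsilon>'"
    and eps_lip: "\<exists>M. lipschitz_on M {0..} \<epsilon>"
    and eps_lim: "(\<epsilon> \<longlongrightarrow> 0) at_top"
    and eps_int: "(\<integral>\<^sup>+ t\<in>{0..}. ennreal (\<epsilon> t) \<partial>lborel) = \<infinity>"
    and k: "k \<ge> 0"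
    and eps_k: "\<And>t. t \<ge> 0 \<Longrightarrow> - k * (\<epsilon> t)\<^sup>2 \<le> \<epsilon>' t"
    and x_ac: "\<And>a b. abs_continuous_on {max 0 a..b} x"
    and v_ac: "\<And>a b. abs_continuous_on {max 0 a..b} \<upsilon>"
    and incl: "\<And>t. t \<ge> 0 \<Longrightarrow> \<upsilon> t = gradPhi (x t)"
    and ode: "AE t in lborel. t \<ge> 0 \<longrightarrow>
      (\<exists>dx dv. (x has_vector_derivative dx) (at t within {0..}) \<and>
               (\<upsilon> has_vector_derivative dv) (at t within {0..}) \<and>
               lam *\<^sub>R dx + dv + \<upsilon> t + \<epsilon> t *\<^sub>R x t = 0)"
  shows "\<exists>p\<in>C. (\<forall>c\<in>C. norm p \<le> norm c) \<and>
           (x \<longlongrightarrow> p) at_top \<and> ((\<lambda>t. x t + \<mu> *\<^sub>R \<upsilon> t) \<longlongrightarrow> p) at_top"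
proof -
  have mu0: "\<mu> > 0" "\<mu> * lam = 1" using lam mu by simp_all
  have contPhi: "continuous_on UNIV \<Phi>"
    using Phi_grad has_derivative_continuous by (blast intro: continuous_at_imp_continuous_on)
  obtain z0 where "\<Phi> z0 = 0" using C_ne C_def by blast
  from convex_min_norm_zero[OF Phi_convex contPhi Phi_nonneg this] obtain p where
    p: "\<Phi> p = 0" and p_min: "\<And>z. \<Phi> z = 0 \<Longrightarrow> norm p \<le> norm z" and
    p_lower: "\<And>\<delta>. \<delta> > 0 \<Longrightarrow> \<exists>a>0. \<forall>z. \<Phi> z \<le> a \<longrightarrow> (norm p)\<^sup>2 - \<delta> \<le> (norm z)\<^sup>2"
    by blast
  \<comment> \<open>As a zero of the nonnegative \<open>\<Phi>\<close>, \<open>p\<close> is a global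
    minimiser, so the derivative vanishes there.\<close>
  have "(\<lambda>h. gradPhi p \<bullet> h) = (\<lambda>h. 0)"
    using p Phi_nonneg by (intro has_derivative_local_min[OF Phi_grad]) auto
  then have gp: "gradPhi p = 0" by (metis inner_eq_zero_iff)
  have phi_le: "\<Phi> (x s) \<le> \<upsilon> s \<bullet> (x s - p)" if "s \<ge> 0" for s
    using gradient_inequality[OF Phi_convex Phi_grad[of "x s"], of p] p incl[OF that]
    by (simp add: inner_diff_right)
  have v_le: "\<mu> * norm (\<upsilon> s) \<le> norm (x s - p)" if "s \<ge> 0" for s
  proof -
    \<comment> \<open>Since \<open>gradPhi p = 0\<close>, the Lipschitz bound between
      \<open>x s\<close> and \<open>p\<close> controls \<open>\<upsilon> s\<close> itself;
      \<open>\<mu> * L < 1\<close> brings the constant down to 1, as \<open>tikhonov_drift\<close>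
      requires.\<close>
    have "\<mu> * norm (\<upsilon> s) \<le> \<mu> * (L * norm (x s - p))"
      using grad_lip[of "x s" p] incl[OF that] gp mu0 by simp
    also have "\<dots> \<le> 1 * norm (x s - p)"
      unfolding mult.assoc[symmetric] using muL by (intro mult_right_mono) auto
    finally show ?thesis by simp
  qed

  \<comment> \<open>Extending \<open>\<epsilon>\<close> to negative times by the constant
    \<open>\<epsilon> 0\<close> makes it continuous on the whole line, so that it has a two-sided
    antiderivative everywhere.\<close>
  define e where "e s = \<epsilon> (max 0 s)" for s
  define y where "y s = x s + \<mu> *\<^sub>R \<upsilon> s" for s
  define G where "G s = - (\<mu> *\<^sub>R (\<upsilon> s + e s *\<^sub>R x s))" for s
  have e_eq: "e s = \<epsilon> s" if "s \<ge> 0" for s using that by (simp add: e_def)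
  have e_nonneg: "e s \<ge> 0" for s using eps_nonneg by (simp add: e_def)
  have "continuous_on {0..} \<epsilon>" using eps_C1 by (intro DERIV_continuous_on) auto
  then have e_cont: "continuous_on UNIV e"
    unfolding e_def by (rule continuous_on_compose2) (auto intro!: continuous_intros)
  have e_lim: "(e \<longlongrightarrow> 0) at_top"
    using eps_lim
  proof (rule Lim_transform_eventually)
    show "eventually (\<lambda>s. \<epsilon> s = e s) at_top"
      using eventually_ge_at_top[of 0] by eventually_elim (simp add: e_eq)
  qed

  have "isCont e s" for s using e_cont continuous_on_eq_continuous_at open_UNIV by blast
  then obtain F where "\<And>s. (F has_vector_derivative e s) (at s)"
    using einterval_antiderivative[of "-\<infinity>" \<infinity> e] by auto
  then have F: "(F has_real_derivative e s) (at s)" for s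
    by (simp add: has_real_derivative_iff_has_vector_derivative)
  have "(\<integral>\<^sup>+ t\<in>{0..}. ennreal (e t) \<partial>lborel) = (\<integral>\<^sup>+ t\<in>{0..}. ennreal (\<epsilon> t) \<partial>lborel)"
    by (intro nn_integral_cong) (auto simp: e_eq indicator_def)
  then have F_top: "filterlim F at_top at_top"
    using e_cont F e_nonneg eps_int
    by (intro antiderivative_at_top_of_nn_integral_infinite[of e 0 F]) (auto intro: borel_measurable_continuous_onI)

  \<comment> \<open>Classical differentiability of \<open>y\<close>\<close>
  obtain N where N: "negligible N" and N_ode: "\<And>s. s \<notin> N \<Longrightarrow> s \<ge> 0 \<Longrightarrow>
      (\<exists>dx dv. (x has_vector_derivative dx) (at s within {0..}) \<and>
               (\<upsilon> has_vector_derivative dv) (at s within {0..}) \<and>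
               lam *\<^sub>R dx + dv + \<upsilon> s + \<epsilon> s *\<^sub>R x s = 0)"
  proof -
    obtain N where "N \<in> null_sets lborel" "{s \<in> space lborel. \<not> (s \<ge> 0 \<longrightarrow>
      (\<exists>dx dv. (x has_vector_derivative dx) (at s within {0..}) \<and>
               (\<upsilon> has_vector_derivative dv) (at s within {0..}) \<and>
               lam *\<^sub>R dx + dv + \<upsilon> s + \<epsilon> s *\<^sub>R x s = 0))} \<subseteq> N"
      using ode by (auto simp: eventually_ae_filter)
    then show thesis
      by (intro that[of N]) (auto simp: negligible_iff_null_sets null_sets_completionI)
  qed
  have y_ae: "(y has_vector_derivative G s) (at s within {0..})" if s: "s \<notin> N" "s \<ge> 0" for s
  proof -
    obtain dx dv where d: "(x has_vector_derivative dx) (at s within {0..})"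
      "(\<upsilon> has_vector_derivative dv) (at s within {0..})"
      and eq: "lam *\<^sub>R dx + dv + \<upsilon> s + \<epsilon> s *\<^sub>R x s = 0"
      using N_ode[OF s] by blast
    \<comment> \<open>Multiplying the equation by \<open>\<mu>\<close> and using
      \<open>\<mu> * lam = 1\<close> isolates \<open>dx + \<mu> *\<^sub>R dv\<close>, the derivative
      of \<open>y\<close>.\<close>
    have "\<mu> *\<^sub>R (lam *\<^sub>R dx + dv + \<upsilon> s + \<epsilon> s *\<^sub>R x s) = 0" by (simp add: eq)
    then have "dx + \<mu> *\<^sub>R dv = G s"
      using mu0(2) s(2) by (simp add: G_def e_eq scaleR_add_right add_eq_0_iff2 add.assoc)
    moreover have "(y has_vector_derivative dx + \<mu> *\<^sub>R dv) (at s within {0..})"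
      unfolding y_def using d by (auto intro!: derivative_eq_intros)
    ultimately show ?thesis by simp
  qed
  have y_deriv: "(y has_vector_derivative G t) (at t)" if t: "t > 0" for t
  proof -
    have x_ac': "abs_continuous_on {0..t + 1} x" and v_ac': "abs_continuous_on {0..t + 1} \<upsilon>"
      using x_ac[of 0 "t + 1"] v_ac[of 0 "t + 1"] by simp_all
    \<comment> \<open>The right endpoint \<open>t + 1\<close> and the condition \<open>t > 0\<close>
      place \<open>t\<close> in the interior, so the one-interval derivative is two-sided.\<close>
    have "(y has_vector_derivative G t) (at t within {0..t + 1})"
    proof (rule has_vector_derivative_of_AE_abs_continuous[OF _ N])
      show "abs_continuous_on {0..t + 1} y"
        unfolding y_def by (intro abs_continuous_on_add abs_continuous_on_scaleR x_ac' v_ac')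
      show "(y has_vector_derivative G s) (at s within {0..t + 1})" if "s \<in> {0..t + 1} - N" for s
        using that by (intro has_vector_derivative_within_subset[OF y_ae]) auto
      show "continuous_on {0..t + 1} G"
        unfolding G_def
        by (intro continuous_intros abs_continuous_on_imp_continuous_on x_ac' v_ac'
            continuous_on_subset[OF e_cont]) auto
    qed (use t in auto)
    then show ?thesis using t by (simp add: at_within_Icc_at)
  qed

  \<comment> \<open>Decay of the distance to \<open>p\<close>\<close>
  have theta_deriv: "((\<lambda>s. (norm (y s - p))\<^sup>2) has_real_derivative 2 * ((y t - p) \<bullet> G t)) (at t)"
    if "t > 0" for t
    unfolding power2_norm_eq_inner has_field_derivative_def
    using y_deriv[OF that] unfolding has_vector_derivative_def
    by (auto intro!: derivative_eq_intros simp: inner_commute algebra_simps)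
  have theta_small: "eventually (\<lambda>s. (norm (y s - p))\<^sup>2 < \<eta>) at_top" if "\<eta> > 0" for \<eta>
  proof -
    \<comment> \<open>With this choice the asymptotic level \<open>5 * \<delta>\<close> equals
      \<open>\<eta> / 2\<close>, strictly below \<open>\<eta>\<close>.\<close>
    define \<delta> where "\<delta> = \<eta> / 10"
    have \<delta>: "\<delta> > 0" "5 * \<delta> < \<eta>" using that by (simp_all add: \<delta>_def)
    obtain a where a: "a > 0" "\<And>z. \<Phi> z \<le> a \<Longrightarrow> (norm p)\<^sup>2 - \<delta> \<le> (norm z)\<^sup>2"
      using p_lower[OF \<delta>(1)] by blast
    have "((\<lambda>s. e s * (norm p)\<^sup>2) \<longlongrightarrow> 0 * (norm p)\<^sup>2) at_top"
      "((\<lambda>s. 2 * \<mu> * e s * (norm p)\<^sup>2) \<longlongrightarrow> 2 * \<mu> * 0 * (norm p)\<^sup>2) at_top"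
      by (intro tendsto_intros e_lim)+
    then have "eventually (\<lambda>s. e s * (norm p)\<^sup>2 < 2 * a) at_top"
      "eventually (\<lambda>s. 2 * \<mu> * e s * (norm p)\<^sup>2 < \<delta>) at_top"
      using a(1) \<delta>(1) by (simp_all add: order_tendstoD(2))
    then have "eventually (\<lambda>s. e s * (norm p)\<^sup>2 < 2 * a \<and> 2 * \<mu> * e s * (norm p)\<^sup>2 < \<delta> \<and> s > 0) at_top"
      using eventually_gt_at_top[of 0] by eventually_elim auto
    \<comment> \<open>Beyond \<open>T\<close>, the first bound serves
      \<open>tikhonov_lower_bound\<close>, the second \<open>tikhonov_drift\<close>, and positivity
      of the time gives the two-sided derivative.\<close>
    then obtain T where T: "\<And>s. T \<le> s \<Longrightarrow> e s * (norm p)\<^sup>2 < 2 * a \<and> 2 * \<mu> * e s * (norm p)\<^sup>2 < \<delta> \<and> s > 0"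
      by (auto simp: eventually_at_top_linorder)
    show ?thesis
    proof (rule eventually_le_of_linear_decay[OF theta_deriv F _ _ F_top \<delta>(2)])
      fix s assume "T \<le> s"
      note Ts = T[OF this]
      show "2 * ((y s - p) \<bullet> G s) \<le> - (\<mu>/4 * e s * ((norm (y s - p))\<^sup>2 - 5 * \<delta>))"
        unfolding y_def G_def
      proof (rule tikhonov_drift)
        show "e s / 2 * ((norm p)\<^sup>2 - \<delta>) \<le> \<Phi> (x s) + e s / 2 * (norm (x s))\<^sup>2"
          using Ts by (intro tikhonov_lower_bound[OF Phi_nonneg a \<delta>(1)] e_nonneg) auto
      qed (use Ts mu0 e_nonneg Phi_nonneg phi_le v_le in auto)
    qed (use T mu0 in auto)
  qed

  have x_le_y: "norm (x s - p) \<le> norm (y s - p)" if "s \<ge> 0" for s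
  proof -
    \<comment> \<open>This is monotonicity of the gradient between \<open>x s\<close> and
      \<open>p\<close>. Pairing \<open>y s - p\<close> with \<open>x s - p\<close> then only adds a
      nonnegative term to the squared norm of \<open>x s - p\<close>, and Cauchy-Schwarz allows one
      factor to be cancelled.\<close>
    have "0 \<le> \<upsilon> s \<bullet> (x s - p)" using phi_le[OF that] Phi_nonneg order_trans by blast
    moreover have "y s - p = (x s - p) + \<mu> *\<^sub>R \<upsilon> s" by (simp add: y_def)
    then have "(y s - p) \<bullet> (x s - p) = norm (x s - p) * norm (x s - p) + \<mu> * (\<upsilon> s \<bullet> (x s - p))"
      by (simp only: inner_add_left inner_scaleR_left power2_norm_eq_inner[symmetric] power2_eq_square)
    ultimately have "norm (x s - p) * norm (x s - p) \<le> (y s - p) \<bullet> (x s - p)"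
      using mu0 by simp
    also have "\<dots> \<le> norm (y s - p) * norm (x s - p)" by (rule norm_cauchy_schwarz)
    finally show ?thesis by (cases "x s = p") auto
  qed
  have near: "eventually (\<lambda>s. norm (y s - p) < r \<and> norm (x s - p) < r) at_top" if "r > 0" for r
    using theta_small[OF zero_less_power[OF that, of 2]] eventually_ge_at_top[of 0]
  proof eventually_elim
    case (elim s)
    then have "norm (y s - p) < r" using \<open>r > 0\<close> by (auto dest: power_less_imp_less_base)
    then show ?case using x_le_y elim by (auto intro: le_less_trans)
  qed
  have "(x \<longlongrightarrow> p) at_top" "(y \<longlongrightarrow> p) at_top"
    using eventually_mono[OF near] by (auto intro!: tendstoI simp: dist_norm)
  moreover have "p \<in> C" "\<forall>c\<in>C. norm p \<le> norm c" using p p_min by (auto simp: C_def)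
  ultimately show ?thesis unfolding y_def by blast
qed

end
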